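(* Let $h > 0$ be a real number, let $b \in \mathbb{R}^3$, let $$A = \frac{1}{h^2}\begin{bmatrix} 2 & -1 & 0\\ -1 & 2 & -1\\ 0 & -1 & 2\end{bmatrix},$$ and let $x = A^{-1} b$. Then for every $x_0 \in \mathbb{R}^3$, the Gauss--Seidel iterates $(x_k)_{k \ge 0}$ for $Ax=b$ started at $x_0$ satisfy $\lim_{k\to\infty} \|x_{k+1} - x\|_2 = 0$.
   Context: Write $A = M + N$, where $M$ is the lower triangular part of $A$ including the diagonal and $N$ is the strictly upper triangular part of $A$. The Gauss--Seidel iterates started at $x_0$ are defined recursively by $x_{k+1} = -M^{-1} N x_k + M^{-1} b$ for $k \ge 0$. $\|\cdot\|_2$ is the Euclidean ($\ell^2$) vector norm. *)

theory Defs
  imports "HOL-Analysis.Analysis"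
begin

definition lower_part ::
  "real ^ ('n::{finite,linorder}) ^ ('n::{finite,linorder}) \<Rightarrow>
     real ^ ('n::{finite,linorder}) ^ ('n::{finite,linorder})" where
  "lower_part A = (\<chi> i j. if j \<le> i then A $ i $ j else 0)"

definition strict_upper_part ::
  "real ^ ('n::{finite,linorder}) ^ ('n::{finite,linorder}) \<Rightarrow>
     real ^ ('n::{finite,linorder}) ^ ('n::{finite,linorder})" where
  "strict_upper_part A = (\<chi> i j. if i < j then A $ i $ j else 0)"

primrec gauss_seidel ::
  "real ^ ('n::{finite,linorder}) ^ ('n::{finite,linorder}) \<Rightarrow>
     real ^ ('n::{finite,linorder}) \<Rightarrow>
     real ^ ('n::{finite,linorder}) \<Rightarrow> nat \<Rightarrow> real ^ ('n::{finite,linorder})" where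
  "gauss_seidel A b x0 0 = x0"
| "gauss_seidel A b x0 (Suc k) =
     - (matrix_inv (lower_part A) ** strict_upper_part A) *v gauss_seidel A b x0 k
       + matrix_inv (lower_part A) *v b"

(* The library's order on the index type 3 is 0 < 1 < 2, where 3 = 0, so matrices written with
   the library's vector [...] (which fills positions 1, 2, 3) have their last row and column at
   the least index. The triangular parts above depend on the order, so rows and columns are
   listed here in increasing order of the index. *)

definition index_rank :: "'n::{finite,linorder} \<Rightarrow> nat" where
  "index_rank i = card {j. j < i}"

definition matrix_of_rows ::
  "real list list \<Rightarrow> real ^ ('n::{finite,linorder}) ^ ('n::{finite,linorder})" where
  "matrix_of_rows rs = (\<chi> i j. rs ! index_rank i ! index_rank j)"

definition laplace_matrix :: "real \<Rightarrow> real ^ 3 ^ 3" where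
  "laplace_matrix h = (1 / h\<^sup>2) *\<^sub>R matrix_of_rows
     [[ 2, -1,  0],
      [-1,  2, -1],
      [ 0, -1,  2]]"

end

(* With M and N the triangular parts of A, the error e k = x k - x satisfies M e (k+1) = - N e k.
   For one step e -> e' this reads 2 e'0 = e1, 2 e'1 = e'0 + e2, 2 e'2 = e'1, so e' = (e1/2, u, u/2)
   with u = e1/4 + e2/2, and 49/64 |e|^2 - |e'|^2 is a sum of squares. Hence the Euclidean norm of
   the error shrinks by a factor of at least 8/7 in each step. *)

theory Submission
  imports Defs
begin

lemma lower_part_add_strict_upper_part: "lower_part A + strict_upper_part A = A"
  by (auto simp: vec_eq_iff lower_part_def strict_upper_part_def)

lemma invertible_if_trivial_kernel:
  fixes A :: "'a::field ^ 'n ^ 'n"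
  assumes "\<And>v. A *v v = 0 \<Longrightarrow> v = 0"
  shows "invertible A"
  using assms by (simp add: invertible_left_inverse matrix_left_invertible_ker)

text \<open>\<open>matrix_inv\<close> is a choice of a two-sided inverse, so its defining property
  becomes available only once some inverse exists.\<close>

lemma matrix_inv_vector_mult:
  fixes A :: "real ^ 'n ^ 'n"
  assumes "invertible A"
  shows "A *v (matrix_inv A *v b) = b"
proof -
  have "A ** matrix_inv A = mat 1"
    using assms unfolding invertible_def matrix_inv_def by (rule someI2_ex) simp
  then show ?thesis
    by (simp add: matrix_vector_mul_assoc)
qed

text \<open>Multiplying the recursion by M gives M x (k+1) = b - N x k; subtracting M x = b - N x
  leaves the errors. Keeping M on the left avoids computing its inverse: the step can be solved by
  forward substitution.\<close>

lemma gauss_seidel_Suc_error: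
  assumes M: "invertible (lower_part A)" and x: "A *v x = b"
  shows "lower_part A *v (gauss_seidel A b x0 (Suc k) - x)
    = - (strict_upper_part A *v (gauss_seidel A b x0 k - x))"
proof -
  let ?M = "lower_part A" and ?N = "strict_upper_part A"
  have b: "b = ?M *v x + ?N *v x"
    using x by (simp add: lower_part_add_strict_upper_part flip: matrix_vector_mult_add_rdistrib)
  have "gauss_seidel A b x0 (Suc k) = matrix_inv ?M *v (b - ?N *v gauss_seidel A b x0 k)"
  proof -
    \<comment> \<open>The minus sign on the left negates the matrix; writing it as a difference from
      0 moves it onto the vector.\<close>
    have "- (matrix_inv ?M ** ?N) *v y = - (matrix_inv ?M *v (?N *v y))" for y
      using matrix_vector_mult_diff_rdistrib[of 0 "matrix_inv ?M ** ?N" y]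
      by (simp add: matrix_vector_mul_assoc)
    then show ?thesis
      by (simp add: matrix_vector_mult_diff_distrib)
  qed
  then have "?M *v gauss_seidel A b x0 (Suc k) = b - ?N *v gauss_seidel A b x0 k"
    by (simp only: matrix_inv_vector_mult[OF M])
  then show ?thesis
    by (simp add: b matrix_vector_mult_diff_distrib del: gauss_seidel.simps)
qed

lemma UNIV_3_eq: "(UNIV :: 3 set) = {0, 1, 2}"
  using UNIV_3 by auto

text \<open>The type \<open>3\<close> is an instance of \<open>bit1\<close>, ordered by the integer
  representatives 0, 1, 2.\<close>

lemma less_3_simps [simp]:
  "(0::3) < 1" "(0::3) < 2" "(1::3) < 2" "\<not> (1::3) < 0" "\<not> (2::3) < 0" "\<not> (2::3) < 1"
  by (simp_all add: less_bit1_def bit1.Rep_0 bit1.Rep_1 bit1.Rep_numeral)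

lemma le_3_simps [simp]:
  "(0::3) \<le> 1" "(0::3) \<le> 2" "(1::3) \<le> 2" "\<not> (1::3) \<le> 0" "\<not> (2::3) \<le> 0" "\<not> (2::3) \<le> 1"
  by (simp_all only: not_le less_3_simps less_imp_le)

lemma neq_3_simps [simp]: "(0::3) \<noteq> 1" "(0::3) \<noteq> 2" "(1::3) \<noteq> 2"
  using less_3_simps(1-3) by (auto simp del: less_3_simps)

lemma sum_3_eq: "sum f (UNIV :: 3 set) = f 0 + f 1 + f 2"
  unfolding UNIV_3_eq by (simp add: add.assoc)

lemma forall_3_eq: "(\<forall>i::3. P i) \<longleftrightarrow> P 0 \<and> P 1 \<and> P 2"
proof -
  have "(\<forall>i. P i) \<longleftrightarrow> (\<forall>i\<in>{0, 1, 2}. P i)"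
    by (simp only: flip: UNIV_3_eq) simp
  then show ?thesis
    by simp
qed

lemma index_rank_3: "index_rank (0::3) = 0" "index_rank (1::3) = 1" "index_rank (2::3) = 2"
proof -
  have "{j::3. j < 0} = {}" "{j::3. j < 1} = {0}" "{j::3. j < 2} = {0, 1}"
    by (simp_all add: set_eq_iff forall_3_eq)
  then show "index_rank (0::3) = 0" "index_rank (1::3) = 1" "index_rank (2::3) = 2"
    by (simp_all add: index_rank_def)
qed

lemma laplace_lower_part_vec:
  fixes v :: "real ^ 3"
  shows "(lower_part (laplace_matrix h) *v v) $ 0 = (2 * v $ 0) / h\<^sup>2"
    and "(lower_part (laplace_matrix h) *v v) $ 1 = (2 * v $ 1 - v $ 0) / h\<^sup>2"
    and "(lower_part (laplace_matrix h) *v v) $ 2 = (2 * v $ 2 - v $ 1) / h\<^sup>2"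
  by (simp_all add: laplace_matrix_def matrix_of_rows_def index_rank_3 lower_part_def
      matrix_vector_mult_def sum_3_eq diff_divide_distrib)

lemma laplace_strict_upper_part_vec:
  fixes v :: "real ^ 3"
  shows "(strict_upper_part (laplace_matrix h) *v v) $ 0 = - v $ 1 / h\<^sup>2"
    and "(strict_upper_part (laplace_matrix h) *v v) $ 1 = - v $ 2 / h\<^sup>2"
    and "(strict_upper_part (laplace_matrix h) *v v) $ 2 = 0"
  by (simp_all add: laplace_matrix_def matrix_of_rows_def index_rank_3 strict_upper_part_def
      matrix_vector_mult_def sum_3_eq)

text \<open>Forward substitution: the rows of M v = 0 force \<open>v $ 0\<close>,
  \<open>v $ 1\<close> and \<open>v $ 2\<close> to vanish in turn.\<close>

lemma invertible_laplace_lower_part: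
  assumes "h > 0"
  shows "invertible (lower_part (laplace_matrix h))"
proof (rule invertible_if_trivial_kernel)
  fix v assume "lower_part (laplace_matrix h) *v v = 0"
  with assms show "v = 0"
    by (simp add: vec_eq_iff forall_3_eq laplace_lower_part_vec)
qed

text \<open>In the kernel, the outer rows give \<open>v $ 0\<close> = \<open>v $ 2\<close> =
  \<open>v $ 1\<close> / 2, and the middle row then reads 2 \<open>v $ 1\<close> =
  \<open>v $ 1\<close>.\<close>

lemma invertible_laplace_matrix:
  assumes "h > 0"
  shows "invertible (laplace_matrix h)"
proof (rule invertible_if_trivial_kernel)
  fix v assume v: "laplace_matrix h *v v = 0"
  let ?A = "laplace_matrix h"
  have "lower_part ?A *v v + strict_upper_part ?A *v v = 0"
    using v by (simp add: lower_part_add_strict_upper_part flip: matrix_vector_mult_add_rdistrib)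
  then have "2 * v $ 0 - v $ 1 = 0" "2 * v $ 1 - v $ 0 - v $ 2 = 0" "2 * v $ 2 - v $ 1 = 0"
    using assms
    by (simp_all add: vec_eq_iff forall_3_eq laplace_lower_part_vec laplace_strict_upper_part_vec
        flip: add_divide_distrib diff_divide_distrib)
  then show "v = 0"
    by (simp add: vec_eq_iff forall_3_eq)
qed

lemma laplace_step_contraction:
  fixes d e :: "real ^ 3"
  assumes "h > 0"
    and "lower_part (laplace_matrix h) *v d = - (strict_upper_part (laplace_matrix h) *v e)"
  shows "norm d \<le> 7 / 8 * norm e"
proof -
  have "2 * d $ 0 = e $ 1" "2 * d $ 1 - d $ 0 = e $ 2" "2 * d $ 2 - d $ 1 = 0"
    using assms
    by (simp_all add: vec_eq_iff forall_3_eq laplace_lower_part_vec laplace_strict_upper_part_vec)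
  then have d: "d $ 0 = e $ 1 / 2" "d $ 1 = e $ 1 / 4 + e $ 2 / 2" "d $ 2 = e $ 1 / 8 + e $ 2 / 4"
    by simp_all
  have norm_sq: "(norm v)\<^sup>2 = (v $ 0)\<^sup>2 + (v $ 1)\<^sup>2 + (v $ 2)\<^sup>2" for v :: "real ^ 3"
    by (simp only: power2_norm_eq_inner) (simp add: inner_vec_def sum_3_eq power2_eq_square)
  \<comment> \<open>Here 64 |d|^2 = 21 e1^2 + 20 e1 e2 + 20 e2^2, and 10 (e1 - e2)^2 absorbs the
    mixed term. Any factor from 31/64 up to but excluding 1 would serve; 49/64 has the rational root
    7/8.\<close>
  have "49 / 64 * (norm e)\<^sup>2 - (norm d)\<^sup>2
      = (49 * (e $ 0)\<^sup>2 + 10 * (e $ 1 - e $ 2)\<^sup>2 + 18 * (e $ 1)\<^sup>2 + 19 * (e $ 2)\<^sup>2) / 64"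
    unfolding norm_sq d by (simp add: power2_eq_square field_simps)
  then have "0 \<le> 49 / 64 * (norm e)\<^sup>2 - (norm d)\<^sup>2"
    by (simp only:) simp
  then have "(norm d)\<^sup>2 \<le> (7 / 8 * norm e)\<^sup>2"
    by (simp add: power_mult_distrib power_divide)
  then show ?thesis
    by (rule power2_le_imp_le) simp
qed

theorem mainTheorem2:
  fixes h :: real and b x :: "real ^ 3" and A :: "real ^ 3 ^ 3"
  assumes "h > 0"
    and "A = laplace_matrix h"
    and "x = matrix_inv A *v b"
  shows "\<forall>x0 :: real ^ 3. (\<lambda>k. norm (gauss_seidel A b x0 (k + 1) - x)) \<longlonglongrightarrow> 0"
proof
  fix x0 :: "real ^ 3"
  let ?e = "\<lambda>k. norm (gauss_seidel A b x0 k - x)"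
  \<comment> \<open>Invertibility of A makes \<open>x\<close> a true solution, that is, a fixed
    point of the iteration.\<close>
  have "A *v x = b"
    using assms invertible_laplace_matrix matrix_inv_vector_mult by blast
  then have step: "?e (Suc k) \<le> 7 / 8 * ?e k" for k
    using assms(1,2) gauss_seidel_Suc_error invertible_laplace_lower_part laplace_step_contraction
    by blast
  have bound: "?e k \<le> (7 / 8) ^ k * ?e 0" for k
  proof (induction k)
    case (Suc k)
    then show ?case
      using step[of k] by (simp del: gauss_seidel.simps)
  qed simp
  have "?e \<longlonglongrightarrow> 0"
  \<comment> \<open>Comparison with the geometric sequence of ratio 7/8 scaled by the initial
    error.\<close>
  proof (rule tendsto_0_le[where K = 1])
    show "(\<lambda>k. (7 / 8) ^ k * ?e 0) \<longlonglongrightarrow> 0"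
      by (intro tendsto_mult_left_zero LIMSEQ_realpow_zero) auto
    show "\<forall>\<^sub>F k in sequentially. norm (?e k) \<le> norm ((7 / 8) ^ k * ?e 0) * 1"
      using bound by (simp add: abs_mult del: gauss_seidel.simps)
  qed
  then show "(\<lambda>k. ?e (k + 1)) \<longlonglongrightarrow> 0"
    by (rule LIMSEQ_ignore_initial_segment)
qed

end
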